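(* Let $A\in\mathbb{R}^{m\times n}$ and $b\in\mathbb{R}^m$ be such that $Ax=b$ is consistent, and let $f:\mathbb{R}^n\to\mathbb{R}$ be $\gamma$-strongly convex with $\gamma>0$. Suppose that the ASDCD algorithm (Algorithm I in the context) and its reformulation (Algorithm II in the context) share the same sampling matrices $\{S_k\}_{k\ge1}$ and the same initial points $z^0\in\mathrm{Range}(A^\top)$ and $\xi^0\in\mathbb{R}^m$. Let $\{z^k\}_{k\ge0}$ be generated by Algorithm I and $\{h^k,q^k,\delta_k\}_{k\ge0}$ by Algorithm II. Then for every $k\ge0$, $$z^k=h^k+\delta_kq^k.$$ That is, the two algorithms are equivalent.
   Context: $f^*(y)=\sup_x\{\langle y,x\rangle-f(x)\}$ is the conjugate of $f$; since $f$ is $\gamma$-strongly convex, $f^*$ is differentiable. Convention: $\frac00=0$. Each $S_k$ is a real matrix with $m$ rows. **Algorithm I (ASDCD).** Set $z^1=z^0+A^\top\xi^0$, $\rho_1=\langle\xi^0,b\rangle$, $x^0=\nabla f^*(z^0)$, $x^1=\nabla f^*(z^1)$. For $k=1,2,\dots$: set $d^k=A^\top S_kS_k^\top(Ax^k-b)$ and $\Delta^k=z^k-z^{k-1}$. If $\|d^k\|_2^2\|\Delta^k\|_2^2-\langle d^k,\Delta^k\rangle^2=0$, set $\beta_k=0$ and $\alpha_k=\gamma\|S_k^\top(Ax^k-b)\|_2^2/\|d^k\|_2^2$ if $S_k^\top(Ax^k-b)\neq0$, $\alpha_k=0$ otherwise. Else set $$\alpha_k=\gamma\frac{\|S_k^\top(Ax^k-b)\|_2^2\|\Delta^k\|_2^2-\langle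 d^k,\Delta^k\rangle(\langle\Delta^k,x^k\rangle-\rho_k)}{\|d^k\|_2^2\|\Delta^k\|_2^2-\langle d^k,\Delta^k\rangle^2},\quad \beta_k=\gamma\frac{-\|d^k\|_2^2(\langle\Delta^k,x^k\rangle-\rho_k)+\langle d^k,\Delta^k\rangle\|S_k^\top(Ax^k-b)\|_2^2}{\|d^k\|_2^2\|\Delta^k\|_2^2-\langle d^k,\Delta^k\rangle^2}.$$ Then $z^{k+1}=z^k-\alpha_kd^k+\beta_k(z^k-z^{k-1})$, $\rho_{k+1}=-\alpha_k\langle S_kS_k^\top(Ax^k-b),b\rangle+\beta_k\rho_k$, $x^{k+1}=\nabla f^*(z^{k+1})$. **Algorithm II (reformulation).** (All of $d^k,\alpha_k,\beta_k$ below are computed by this algorithm itself.) Set $(h^0,q^0,\delta_0)=(z^0,0,1)$, $(h^1,q^1,\delta_1)=(z^0+2A^\top\xi^0,-2A^\top\xi^0,\frac12)$, $\delta_0^*=1$, $\theta_{-1}=\theta_0=\frac12$, $\beta_0=0$, $l_1=\|q^1\|_2^2$, $\tau_1=-2\langle\xi^0,b\rangle$. For $k=1,2,\dots$: write $g^k=\nabla f^*(h^k+\delta_kq^k)$, and compute $d_1^k=S_k^\top Ag^k-S_k^\top b$, $d^k=A^\top S_kd_1^k$. If $\|d^k\|_2^2l_k-\langle d^k,q^k\rangle^2=0$ or $\|d^k\|_2^2(\langle q^k,g^k\rangle-\tau_k)-\langle d^k,q^k\rangle\|d_1^k\|_2^2=0$, perform Stage I; otherwise perform Stage II. *Stage I.*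 Set $\beta_k=0$, $\theta_k=\frac12$, $\delta_k^*=1$, $\alpha_k=\gamma\|d_1^k\|_2^2/\|d^k\|_2^2$, and $$(h^{k+1},q^{k+1},\delta_{k+1})=\left(h^k+\delta_kq^k-2\alpha_kd^k,\;2\alpha_kd^k,\;\tfrac12\right),\quad (l_{k+1},\tau_{k+1})=\left(4\alpha_k^2\|d^k\|_2^2,\;2\alpha_k\langle d_1^k,S_k^\top b\rangle\right).$$ *Stage II.* Set $$\alpha_k=\gamma\frac{\|d_1^k\|_2^2l_k-\langle d^k,q^k\rangle(\langle q^k,g^k\rangle-\tau_k)}{\|d^k\|_2^2l_k-\langle d^k,q^k\rangle^2},\quad\beta_k=\frac{\gamma}{\theta_{k-1}\delta_{k-1}^*}\cdot\frac{\|d^k\|_2^2(\langle q^k,g^k\rangle-\tau_k)-\langle d^k,q^k\rangle\|d_1^k\|_2^2}{\|d^k\|_2^2l_k-\langle d^k,q^k\rangle^2}.$$ If $\theta_{k-1}\neq1$: set $\delta_k^*=\delta_k$; set $\theta_k=\frac{\theta_{k-1}}{1-\theta_{k-1}}\beta_k$ if $\theta_{k-2}\neq1$ or $\beta_{k-1}=0$, and $\theta_k=-\beta_k$ otherwise; and $$(h^{k+1},q^{k+1},\delta_{k+1})=\left(h^k-\tfrac{\alpha_k}{\theta_k}d^k,\;q^k+\tfrac{\alpha_k}{\delta_k^*\theta_k}d^k,\;(1-\theta_k)\delta_k^*\right).$$ If $\theta_{k-1}=1$: set $\delta_k^*=2\delta_{k-1}^*\beta_k$, $\theta_k=\frac12$,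 and $$(h^{k+1},q^{k+1},\delta_{k+1})=\left(h^k,\;q^k+\tfrac{\alpha_k}{\delta_k^*\theta_k}d^k,\;-\theta_k\delta_k^*\right).$$ In both cases set $$(l_{k+1},\tau_{k+1})=\left(l_k+2\tfrac{\alpha_k}{\delta_k^*\theta_k}\langle d^k,q^k\rangle+\tfrac{\alpha_k^2}{(\delta_k^* )^2\theta_k^2}\|d^k\|_2^2,\;\tau_k+\tfrac{\alpha_k}{\delta_k^*\theta_k}\langle d_1^k,S_k^\top b\rangle\right).$$ *)

theory Defs
  imports "HOL-Analysis.Analysis" "HOL-Library.ListVector"
begin

definition strongly_convex :: "real \<Rightarrow> ('a::real_inner \<Rightarrow> real) \<Rightarrow> bool" where
  "strongly_convex \<gamma> f \<longleftrightarrow>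
     (\<forall>x y. \<forall>t\<in>{0..1}.
        f (t *\<^sub>R x + (1 - t) *\<^sub>R y)
          \<le> t * f x + (1 - t) * f y - \<gamma> / 2 * t * (1 - t) * (norm (x - y))\<^sup>2)"

text \<open>For a strongly convex function on a Euclidean space the supremum below is finite at every
  point and the conjugate is differentiable everywhere, so that neither the real-valued supremum
  nor the description operator in the gradient is ever applied outside its intended domain.\<close>

definition conjugate :: "('a::real_inner \<Rightarrow> real) \<Rightarrow> 'a \<Rightarrow> real" where
  "conjugate f y = (SUP x. y \<bullet> x - f x)"

definition gradient :: "('a::real_inner \<Rightarrow> real) \<Rightarrow> 'a \<Rightarrow> 'a" where
  "gradient f x = (THE D. GDERIV f x :> D)"

text \<open>The number of columns of the sampling matrices may change from one iteration to the next,
  so it cannot be a type index. A matrix with rows indexed by \<open>'m\<close> is given by the list of its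
  columns, and vectors in the space indexed by these columns are real lists with the operations of
  \<open>ListVector\<close>; in particular \<open>\<langle>u, v\<rangle>\<close> is the inner product and \<open>\<langle>u, u\<rangle>\<close> the squared Euclidean
  norm of lists.\<close>

type_synonym 'm column_matrix = "(real ^ 'm) list"

definition cm_mult :: "'m::finite column_matrix \<Rightarrow> real list \<Rightarrow> real ^ 'm" where
  "cm_mult S u = (\<Sum>(c, a) \<leftarrow> zip S u. a *\<^sub>R c)"

definition cm_tmult :: "'m::finite column_matrix \<Rightarrow> real ^ 'm \<Rightarrow> real list" where
  "cm_tmult S r = map (\<lambda>c. c \<bullet> r) S"

text \<open>The two predicates below state that the given sequences are generated by the respective
  algorithm. All quantities are determined successively by the equations; the convention
  \<open>0 / 0 = 0\<close> is that of division in HOL. Only \<open>S k\<close> with \<open>k \<ge> 1\<close> is used.\<close>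

definition asdcd ::
  "real ^ 'n ^ 'm \<Rightarrow> real ^ 'm \<Rightarrow> (real ^ 'n \<Rightarrow> real) \<Rightarrow> real \<Rightarrow> (nat \<Rightarrow> 'm column_matrix)
    \<Rightarrow> real ^ 'n \<Rightarrow> real ^ 'm \<Rightarrow> (nat \<Rightarrow> real ^ 'n) \<Rightarrow> bool" where
  "asdcd A b f \<gamma> S z0 \<xi>0 z \<longleftrightarrow>
    (\<exists>(x :: nat \<Rightarrow> real ^ 'n) (\<rho> :: nat \<Rightarrow> real) (d :: nat \<Rightarrow> real ^ 'n) (\<Delta> :: nat \<Rightarrow> real ^ 'n)
      (\<alpha> :: nat \<Rightarrow> real) (\<beta> :: nat \<Rightarrow> real) (u :: nat \<Rightarrow> real list).
      z 0 = z0 \<and> z 1 = z0 + transpose A *v \<xi>0 \<and> \<rho> 1 = \<xi>0 \<bullet> b \<and>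
      x 0 = gradient (conjugate f) (z 0) \<and> x 1 = gradient (conjugate f) (z 1) \<and>
      (\<forall>k\<ge>1.
        u k = cm_tmult (S k) (A *v x k - b) \<and>
        d k = transpose A *v cm_mult (S k) (u k) \<and>
        \<Delta> k = z k - z (k - 1) \<and>
        (if (norm (d k))\<^sup>2 * (norm (\<Delta> k))\<^sup>2 - (d k \<bullet> \<Delta> k)\<^sup>2 = 0
         then \<beta> k = 0 \<and>
           \<alpha> k = (if u k \<noteq> replicate (length (S k)) 0
                  then \<gamma> * \<langle>u k, u k\<rangle> / (norm (d k))\<^sup>2 else 0)
         else
           \<alpha> k = \<gamma> * ((\<langle>u k, u k\<rangle> * (norm (\<Delta> k))\<^sup>2 - (d k \<bullet> \<Delta> k) * (\<Delta> k \<bullet> x k - \<rho> k))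
                     / ((norm (d k))\<^sup>2 * (norm (\<Delta> k))\<^sup>2 - (d k \<bullet> \<Delta> k)\<^sup>2)) \<and>
           \<beta> k = \<gamma> * ((- (norm (d k))\<^sup>2 * (\<Delta> k \<bullet> x k - \<rho> k) + (d k \<bullet> \<Delta> k) * \<langle>u k, u k\<rangle>)
                     / ((norm (d k))\<^sup>2 * (norm (\<Delta> k))\<^sup>2 - (d k \<bullet> \<Delta> k)\<^sup>2))) \<and>
        z (k + 1) = z k - \<alpha> k *\<^sub>R d k + \<beta> k *\<^sub>R (z k - z (k - 1)) \<and>
        \<rho> (k + 1) = - \<alpha> k * (cm_mult (S k) (u k) \<bullet> b) + \<beta> k * \<rho> k \<and>
        x (k + 1) = gradient (conjugate f) (z (k + 1))))"

text \<open>\<open>\<theta>\<close> is indexed by integers because its indices start at \<open>- 1\<close>.\<close>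

definition asdcd_reformulation ::
  "real ^ 'n ^ 'm \<Rightarrow> real ^ 'm \<Rightarrow> (real ^ 'n \<Rightarrow> real) \<Rightarrow> real \<Rightarrow> (nat \<Rightarrow> 'm column_matrix)
    \<Rightarrow> real ^ 'n \<Rightarrow> real ^ 'm \<Rightarrow> (nat \<Rightarrow> real ^ 'n) \<Rightarrow> (nat \<Rightarrow> real ^ 'n) \<Rightarrow> (nat \<Rightarrow> real) \<Rightarrow> bool" where
  "asdcd_reformulation A b f \<gamma> S z0 \<xi>0 h q \<delta> \<longleftrightarrow>
    (\<exists>(\<delta>s :: nat \<Rightarrow> real) (\<theta> :: int \<Rightarrow> real) (\<alpha> :: nat \<Rightarrow> real) (\<beta> :: nat \<Rightarrow> real)
      (l :: nat \<Rightarrow> real) (\<tau> :: nat \<Rightarrow> real) (g :: nat \<Rightarrow> real ^ 'n)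
      (d1 :: nat \<Rightarrow> real list) (d :: nat \<Rightarrow> real ^ 'n).
      (h 0, q 0, \<delta> 0) = (z0, 0, 1) \<and>
      (h 1, q 1, \<delta> 1) = (z0 + 2 *\<^sub>R (transpose A *v \<xi>0), - 2 *\<^sub>R (transpose A *v \<xi>0), 1 / 2) \<and>
      \<delta>s 0 = 1 \<and> \<theta> (- 1) = 1 / 2 \<and> \<theta> 0 = 1 / 2 \<and> \<beta> 0 = 0 \<and>
      l 1 = (norm (q 1))\<^sup>2 \<and> \<tau> 1 = - 2 * (\<xi>0 \<bullet> b) \<and>
      (\<forall>k\<ge>1.
        g k = gradient (conjugate f) (h k + \<delta> k *\<^sub>R q k) \<and>
        d1 k = cm_tmult (S k) (A *v g k) - cm_tmult (S k) b \<and>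
        d k = transpose A *v cm_mult (S k) (d1 k) \<and>
        (if (norm (d k))\<^sup>2 * l k - (d k \<bullet> q k)\<^sup>2 = 0 \<or>
            (norm (d k))\<^sup>2 * (q k \<bullet> g k - \<tau> k) - (d k \<bullet> q k) * \<langle>d1 k, d1 k\<rangle> = 0
         then
           \<beta> k = 0 \<and> \<theta> (int k) = 1 / 2 \<and> \<delta>s k = 1 \<and>
           \<alpha> k = \<gamma> * \<langle>d1 k, d1 k\<rangle> / (norm (d k))\<^sup>2 \<and>
           (h (k + 1), q (k + 1), \<delta> (k + 1))
             = (h k + \<delta> k *\<^sub>R q k - (2 * \<alpha> k) *\<^sub>R d k, (2 * \<alpha> k) *\<^sub>R d k, 1 / 2) \<and>
           (l (k + 1), \<tau> (k + 1))
             = (4 * (\<alpha> k)\<^sup>2 * (norm (d k))\<^sup>2, 2 * \<alpha> k * \<langle>d1 k, cm_tmult (S k) b\<rangle>)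
         else
           \<alpha> k = \<gamma> * ((\<langle>d1 k, d1 k\<rangle> * l k - (d k \<bullet> q k) * (q k \<bullet> g k - \<tau> k))
                     / ((norm (d k))\<^sup>2 * l k - (d k \<bullet> q k)\<^sup>2)) \<and>
           \<beta> k = \<gamma> / (\<theta> (int k - 1) * \<delta>s (k - 1))
                 * (((norm (d k))\<^sup>2 * (q k \<bullet> g k - \<tau> k) - (d k \<bullet> q k) * \<langle>d1 k, d1 k\<rangle>)
                    / ((norm (d k))\<^sup>2 * l k - (d k \<bullet> q k)\<^sup>2)) \<and>
           (if \<theta> (int k - 1) \<noteq> 1
            then
              \<delta>s k = \<delta> k \<and>
              \<theta> (int k) =
                (if \<theta> (int k - 2) \<noteq> 1 \<or> \<beta> (k - 1) = 0
                 then \<theta> (int k - 1) / (1 - \<theta> (int k - 1)) * \<beta> k else - \<beta> k) \<and>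
              (h (k + 1), q (k + 1), \<delta> (k + 1))
                = (h k - (\<alpha> k / \<theta> (int k)) *\<^sub>R d k,
                   q k + (\<alpha> k / (\<delta>s k * \<theta> (int k))) *\<^sub>R d k,
                   (1 - \<theta> (int k)) * \<delta>s k)
            else
              \<delta>s k = 2 * \<delta>s (k - 1) * \<beta> k \<and> \<theta> (int k) = 1 / 2 \<and>
              (h (k + 1), q (k + 1), \<delta> (k + 1))
                = (h k,
                   q k + (\<alpha> k / (\<delta>s k * \<theta> (int k))) *\<^sub>R d k,
                   - \<theta> (int k) * \<delta>s k)) \<and>
           (l (k + 1), \<tau> (k + 1))
             = (l k + 2 * (\<alpha> k / (\<delta>s k * \<theta> (int k))) * (d k \<bullet> q k)
                  + (\<alpha> k)\<^sup>2 / ((\<delta>s k)\<^sup>2 * (\<theta> (int k))\<^sup>2) * (norm (d k))\<^sup>2,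
                \<tau> k + \<alpha> k / (\<delta>s k * \<theta> (int k)) * \<langle>d1 k, cm_tmult (S k) b\<rangle>))))"

end

theory Submission
  imports Defs
begin

text \<open>With \<open>c\<^sub>k = \<theta>\<^sub>k\<^sub>-\<^sub>1 \<delta>\<^sup>*\<^sub>k\<^sub>-\<^sub>1\<close>, the direction of the reformulation is a rescaled step of ASDCD:
  \<open>z\<^sup>k - z\<^sup>k\<^sup>-\<^sup>1 = - c\<^sub>k q\<^sup>k\<close>, \<open>\<rho>\<^sub>k = - c\<^sub>k \<tau>\<^sub>k\<close> and \<open>l\<^sub>k = \<parallel>q\<^sup>k\<parallel>\<^sup>2\<close>. The formulas for the coefficients are
  homogeneous in the step, so while \<open>c\<^sub>k \<noteq> 0\<close> both algorithms compute the same \<open>\<alpha>\<^sub>k\<close> and \<open>\<beta>\<^sub>k\<close>.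
  The updates of \<open>\<theta>\<close>, \<open>\<delta>\<^sup>*\<close> and \<open>\<delta>\<close> are made so that \<open>c\<^sub>k\<^sub>+\<^sub>1 = \<beta>\<^sub>k c\<^sub>k\<close> in Stage II, which is nonzero,
  and \<open>c\<^sub>k\<^sub>+\<^sub>1 = 1/2\<close> in Stage I, where the momentum vanishes.\<close>

lemma cm_tmult_diff: "cm_tmult S x - cm_tmult S y = cm_tmult S (x - y)"
  by (induction S) (simp_all add: cm_tmult_def inner_diff_right)

lemma length_cm_tmult [simp]: "length (cm_tmult S r) = length S"
  by (simp add: cm_tmult_def)

text \<open>Adjointness holds for lists of any length, since \<open>iprod\<close> and
  \<open>cm_mult\<close> both truncate through \<open>zip\<close>. It matches the inner products
  that update \<open>\<rho>\<close> and \<open>\<tau>\<close>.\<close>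

lemma iprod_cm_tmult: "\<langle>u, cm_tmult S b\<rangle> = cm_mult S u \<bullet> b"
proof (induction S arbitrary: u)
  case Nil
  then show ?case by (simp add: cm_tmult_def cm_mult_def iprod_def)
next
  case (Cons c S)
  then show ?case
    by (cases u) (simp_all add: cm_tmult_def cm_mult_def iprod_def inner_add_left)
qed

lemma iprod_replicate_0: "\<langle>replicate n 0, replicate n (0 :: real)\<rangle> = 0"
  by (induction n) (simp_all add: iprod_def)

lemma gram_rescale:
  fixes c :: real
  shows "D * (norm (- c *\<^sub>R q))\<^sup>2 - (d \<bullet> (- c *\<^sub>R q))\<^sup>2 = c\<^sup>2 * (D * (norm q)\<^sup>2 - (d \<bullet> q)\<^sup>2)"
  by (simp add: power_mult_distrib algebra_simps)

text \<open>Numerator and Gram determinant both have degree two in the step and its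
  \<open>\<rho>\<close>, so \<open>c\<close> cancels.\<close>

lemma alpha_rescale:
  fixes c :: real
  assumes "c \<noteq> 0"
  shows "(U * (norm (- c *\<^sub>R q))\<^sup>2 - (d \<bullet> (- c *\<^sub>R q)) * ((- c *\<^sub>R q) \<bullet> x - (- c * \<tau>)))
      / (c\<^sup>2 * G) = (U * (norm q)\<^sup>2 - (d \<bullet> q) * (q \<bullet> x - \<tau>)) / G"
proof -
  have "U * (norm (- c *\<^sub>R q))\<^sup>2 - (d \<bullet> (- c *\<^sub>R q)) * ((- c *\<^sub>R q) \<bullet> x - (- c * \<tau>))
      = c\<^sup>2 * (U * (norm q)\<^sup>2 - (d \<bullet> q) * (q \<bullet> x - \<tau>))"
    by (simp add: power_mult_distrib power2_eq_square algebra_simps)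
  then show ?thesis using assms by simp
qed

text \<open>The numerator has degree one only, so one factor \<open>c\<close> survives in the
  denominator; it is the \<open>\<theta> (int k - 1) * \<delta>s (k - 1)\<close> in the
  \<open>\<beta> k\<close> of the reformulation.\<close>

lemma beta_rescale:
  fixes c :: real
  assumes "c \<noteq> 0"
  shows "(- D * ((- c *\<^sub>R q) \<bullet> x - (- c * \<tau>)) + (d \<bullet> (- c *\<^sub>R q)) * U) / (c\<^sup>2 * G)
      = (D * (q \<bullet> x - \<tau>) - (d \<bullet> q) * U) / G / c"
proof -
  have "- D * ((- c *\<^sub>R q) \<bullet> x - (- c * \<tau>)) + (d \<bullet> (- c *\<^sub>R q)) * U
      = c * (D * (q \<bullet> x - \<tau>) - (d \<bullet> q) * U)"
    by (simp add: algebra_simps)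
  then show ?thesis using assms by (simp add: power2_eq_square)
qed

text \<open>If the momentum coefficient vanishes, the step length is that of the step without momentum.\<close>

lemma alpha_no_momentum:
  fixes D :: real
  assumes "D * l - p\<^sup>2 \<noteq> 0" and "D * P - p * U = 0" and "D = 0 \<Longrightarrow> p = 0"
  shows "(U * l - p * P) / (D * l - p\<^sup>2) = U / D"
proof -
  have "D \<noteq> 0" using assms by auto
  \<comment> \<open>Expand the left side and replace \<open>D * P\<close> by
    \<open>p * U\<close>.\<close>
  moreover have "D * (U * l - p * P) = U * (D * l - p\<^sup>2)"
    using assms(2) by (simp add: power2_eq_square) algebra
  ultimately show ?thesis using assms(1) by (simp add: field_simps)
qed

theorem proposition4p5:
  fixes A :: "real ^ 'n ^ 'm" and b :: "real ^ 'm"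
    and f :: "real ^ 'n \<Rightarrow> real" and \<gamma> :: real
    and S :: "nat \<Rightarrow> 'm column_matrix"
    and z0 :: "real ^ 'n" and \<xi>0 :: "real ^ 'm"
    and z h q :: "nat \<Rightarrow> real ^ 'n" and \<delta> :: "nat \<Rightarrow> real"
  assumes "\<exists>x. A *v x = b"
    and "\<gamma> > 0" and "strongly_convex \<gamma> f"
    and "z0 \<in> range ((*v) (transpose A))"
    and "asdcd A b f \<gamma> S z0 \<xi>0 z"
    and "asdcd_reformulation A b f \<gamma> S z0 \<xi>0 h q \<delta>"
  shows "\<forall>k. z k = h k + \<delta> k *\<^sub>R q k"
proof -
  obtain x \<rho> e \<Delta> a B u where
    z_init: "z 0 = z0" "z 1 = z0 + transpose A *v \<xi>0" "\<rho> 1 = \<xi>0 \<bullet> b"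
      "x 0 = gradient (conjugate f) (z 0)" "x 1 = gradient (conjugate f) (z 1)"
    and z_step: "\<forall>k\<ge>1.
        u k = cm_tmult (S k) (A *v x k - b) \<and>
        e k = transpose A *v cm_mult (S k) (u k) \<and>
        \<Delta> k = z k - z (k - 1) \<and>
        (if (norm (e k))\<^sup>2 * (norm (\<Delta> k))\<^sup>2 - (e k \<bullet> \<Delta> k)\<^sup>2 = 0
         then B k = 0 \<and>
           a k = (if u k \<noteq> replicate (length (S k)) 0
                  then \<gamma> * \<langle>u k, u k\<rangle> / (norm (e k))\<^sup>2 else 0)
         else
           a k = \<gamma> * ((\<langle>u k, u k\<rangle> * (norm (\<Delta> k))\<^sup>2 - (e k \<bullet> \<Delta> k) * (\<Delta> k \<bullet> x k - \<rho> k))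
                     / ((norm (e k))\<^sup>2 * (norm (\<Delta> k))\<^sup>2 - (e k \<bullet> \<Delta> k)\<^sup>2)) \<and>
           B k = \<gamma> * ((- (norm (e k))\<^sup>2 * (\<Delta> k \<bullet> x k - \<rho> k) + (e k \<bullet> \<Delta> k) * \<langle>u k, u k\<rangle>)
                     / ((norm (e k))\<^sup>2 * (norm (\<Delta> k))\<^sup>2 - (e k \<bullet> \<Delta> k)\<^sup>2))) \<and>
        z (k + 1) = z k - a k *\<^sub>R e k + B k *\<^sub>R (z k - z (k - 1)) \<and>
        \<rho> (k + 1) = - a k * (cm_mult (S k) (u k) \<bullet> b) + B k * \<rho> k \<and>
        x (k + 1) = gradient (conjugate f) (z (k + 1))"
    using assms(5) unfolding asdcd_def by (elim exE conjE) (rule that; assumption)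
  obtain \<delta>s and \<theta> :: "int \<Rightarrow> real" and \<alpha> \<beta> l \<tau> g d1 d where
    h_init: "(h 0, q 0, \<delta> 0) = (z0, 0, 1)"
      "(h 1, q 1, \<delta> 1) = (z0 + 2 *\<^sub>R (transpose A *v \<xi>0), - 2 *\<^sub>R (transpose A *v \<xi>0), 1 / 2)"
      "\<delta>s 0 = 1" "\<theta> (- 1) = 1 / 2" "\<theta> 0 = 1 / 2" "\<beta> 0 = (0::real)"
      "l 1 = (norm (q 1))\<^sup>2" "\<tau> 1 = - 2 * (\<xi>0 \<bullet> b)"
    and h_step: "\<forall>k\<ge>1.
        g k = gradient (conjugate f) (h k + \<delta> k *\<^sub>R q k) \<and>
        d1 k = cm_tmult (S k) (A *v g k) - cm_tmult (S k) b \<and>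
        d k = transpose A *v cm_mult (S k) (d1 k) \<and>
        (if (norm (d k))\<^sup>2 * l k - (d k \<bullet> q k)\<^sup>2 = 0 \<or>
            (norm (d k))\<^sup>2 * (q k \<bullet> g k - \<tau> k) - (d k \<bullet> q k) * \<langle>d1 k, d1 k\<rangle> = 0
         then
           \<beta> k = 0 \<and> \<theta> (int k) = 1 / 2 \<and> \<delta>s k = 1 \<and>
           \<alpha> k = \<gamma> * \<langle>d1 k, d1 k\<rangle> / (norm (d k))\<^sup>2 \<and>
           (h (k + 1), q (k + 1), \<delta> (k + 1))
             = (h k + \<delta> k *\<^sub>R q k - (2 * \<alpha> k) *\<^sub>R d k, (2 * \<alpha> k) *\<^sub>R d k, 1 / 2) \<and>
           (l (k + 1), \<tau> (k + 1))
             = (4 * (\<alpha> k)\<^sup>2 * (norm (d k))\<^sup>2, 2 * \<alpha> k * \<langle>d1 k, cm_tmult (S k) b\<rangle>)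
         else
           \<alpha> k = \<gamma> * ((\<langle>d1 k, d1 k\<rangle> * l k - (d k \<bullet> q k) * (q k \<bullet> g k - \<tau> k))
                     / ((norm (d k))\<^sup>2 * l k - (d k \<bullet> q k)\<^sup>2)) \<and>
           \<beta> k = \<gamma> / (\<theta> (int k - 1) * \<delta>s (k - 1))
                 * (((norm (d k))\<^sup>2 * (q k \<bullet> g k - \<tau> k) - (d k \<bullet> q k) * \<langle>d1 k, d1 k\<rangle>)
                    / ((norm (d k))\<^sup>2 * l k - (d k \<bullet> q k)\<^sup>2)) \<and>
           (if \<theta> (int k - 1) \<noteq> 1
            then
              \<delta>s k = \<delta> k \<and>
              \<theta> (int k) =
                (if \<theta> (int k - 2) \<noteq> 1 \<or> \<beta> (k - 1) = 0
                 then \<theta> (int k - 1) / (1 - \<theta> (int k - 1)) * \<beta> k else - \<beta> k) \<and>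
              (h (k + 1), q (k + 1), \<delta> (k + 1))
                = (h k - (\<alpha> k / \<theta> (int k)) *\<^sub>R d k,
                   q k + (\<alpha> k / (\<delta>s k * \<theta> (int k))) *\<^sub>R d k,
                   (1 - \<theta> (int k)) * \<delta>s k)
            else
              \<delta>s k = 2 * \<delta>s (k - 1) * \<beta> k \<and> \<theta> (int k) = 1 / 2 \<and>
              (h (k + 1), q (k + 1), \<delta> (k + 1))
                = (h k,
                   q k + (\<alpha> k / (\<delta>s k * \<theta> (int k))) *\<^sub>R d k,
                   - \<theta> (int k) * \<delta>s k)) \<and>
           (l (k + 1), \<tau> (k + 1))
             = (l k + 2 * (\<alpha> k / (\<delta>s k * \<theta> (int k))) * (d k \<bullet> q k)
                  + (\<alpha> k)\<^sup>2 / ((\<delta>s k)\<^sup>2 * (\<theta> (int k))\<^sup>2) * (norm (d k))\<^sup>2,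
                \<tau> k + \<alpha> k / (\<delta>s k * \<theta> (int k)) * \<langle>d1 k, cm_tmult (S k) b\<rangle>))"
    using assms(6) unfolding asdcd_reformulation_def by (elim exE conjE) (rule that; assumption)

  define c where "c k = \<theta> (int k - 1) * \<delta>s (k - 1)" for k
  text \<open>The factor by which Stage II multiplies \<open>\<beta>\<^sub>k\<close> to obtain \<open>\<theta>\<^sub>k\<close>.\<close>
  define \<kappa> where "\<kappa> k = (if \<theta> (int k - 2) \<noteq> 1 \<or> \<beta> (k - 1) = 0
    then \<theta> (int k - 1) / (1 - \<theta> (int k - 1)) else - 1)" for k
  \<comment> \<open>The last conjunct prepares the next Stage II step: if
    \<open>\<theta> (int k - 1) \<noteq> 1\<close>, that step takes
    \<open>\<delta>s k = \<delta> k\<close> and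
    \<open>\<theta> (int k) = \<kappa> k * \<beta> k\<close>, so
    \<open>\<kappa> k * \<delta> k = c k\<close> yields
    \<open>c (k + 1) = \<beta> k * c k\<close>.\<close>
  define inv where "inv k \<longleftrightarrow> z k = h k + \<delta> k *\<^sub>R q k \<and> z k - z (k - 1) = - c k *\<^sub>R q k \<and>
    \<rho> k = - c k * \<tau> k \<and> l k = (norm (q k))\<^sup>2 \<and> c k \<noteq> 0 \<and>
    (if \<theta> (int k - 1) = 1 then \<delta> k = 0 else \<delta> k \<noteq> 0 \<and> \<kappa> k * \<delta> k = c k)" for k
  have x_eq: "x k = gradient (conjugate f) (z k)" if "k \<ge> 1" for k
    using z_init(5) z_step[rule_format, of "k - 1"] that by (cases "k = 1") auto

  have inv_step: "inv (k + 1)" if k: "k \<ge> 1" and "inv k" for k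
  proof -
    have zk: "z k = h k + \<delta> k *\<^sub>R q k" and zd: "z k - z (k - 1) = - c k *\<^sub>R q k"
      and rho: "\<rho> k = - c k * \<tau> k" and l: "l k = (norm (q k))\<^sup>2" and c0: "c k \<noteq> 0"
      and del: "if \<theta> (int k - 1) = 1 then \<delta> k = 0 else \<delta> k \<noteq> 0 \<and> \<kappa> k * \<delta> k = c k"
      using \<open>inv k\<close> by (auto simp: inv_def)
    note zs = z_step[rule_format, OF k] and hs = h_step[rule_format, OF k]
    have g: "g k = x k" using hs x_eq[OF k] zk by simp
    have u: "u k = d1 k" using zs hs g by (simp add: cm_tmult_diff)
    have e: "e k = d k" using zs hs u by simp
    define U D G P s where "U = \<langle>d1 k, d1 k\<rangle>" and "D = (norm (d k))\<^sup>2"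
      and "G = D * l k - (d k \<bullet> q k)\<^sup>2"
      and "P = D * (q k \<bullet> g k - \<tau> k) - (d k \<bullet> q k) * U"
      and "s = \<langle>d1 k, cm_tmult (S k) b\<rangle>"
    note defs = U_def D_def G_def P_def s_def
    note stage = hs[THEN conjunct2, THEN conjunct2, THEN conjunct2, folded D_def U_def s_def,
      folded G_def P_def]
    have \<Delta>: "\<Delta> k = - c k *\<^sub>R q k" using zs zd by simp
    \<comment> \<open>Since \<open>c k \<noteq> 0\<close>, the degeneracy test of ASDCD becomes
      \<open>G = 0\<close>.\<close>
    have gram: "(norm (e k))\<^sup>2 * (norm (\<Delta> k))\<^sup>2 - (e k \<bullet> \<Delta> k)\<^sup>2 = (c k)\<^sup>2 * G"
      unfolding \<Delta> e D_def G_def l by (rule gram_rescale)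
    \<comment> \<open>Where ASDCD sets the step length to 0 separately,
      \<open>\<gamma> * U / D\<close> is 0 as well, even if \<open>D = 0\<close>.\<close>
    have U0: "U = 0" if "u k = replicate (length (S k)) 0"
      using that by (simp add: U_def u iprod_replicate_0)
    have degenerate: "B k = 0" "a k = \<gamma> * U / D" if "G = 0"
      using zs that U0 unfolding gram by (auto simp: u e defs split: if_splits)
    have a_eq: "a k = \<gamma> * ((U * l k - (d k \<bullet> q k) * (q k \<bullet> g k - \<tau> k)) / G)" if "G \<noteq> 0"
    proof -
      have "a k = \<gamma> * ((\<langle>u k, u k\<rangle> * (norm (\<Delta> k))\<^sup>2 - (e k \<bullet> \<Delta> k) * (\<Delta> k \<bullet> x k - \<rho> k))
          / ((c k)\<^sup>2 * G))"
        using zs that c0 unfolding gram by auto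
      then show ?thesis
        unfolding \<Delta> u e rho g l U_def using alpha_rescale[OF c0] by metis
    qed
    have B_eq: "B k = \<gamma> / c k * (P / G)" if "G \<noteq> 0"
    proof -
      have "B k = \<gamma> * ((- (norm (e k))\<^sup>2 * (\<Delta> k \<bullet> x k - \<rho> k) + (e k \<bullet> \<Delta> k) * \<langle>u k, u k\<rangle>)
          / ((c k)\<^sup>2 * G))"
        using zs that c0 unfolding gram by auto
      then show ?thesis
        unfolding \<Delta> u e rho beta_rescale[OF c0] by (simp add: P_def D_def U_def g)
    qed
    have z': "z (k + 1) = z k - a k *\<^sub>R d k + B k *\<^sub>R (- c k *\<^sub>R q k)"
      using zs zd e by simp
    have rho': "\<rho> (k + 1) = - a k * s - B k * c k * \<tau> k"
      using zs rho u by (simp add: s_def iprod_cm_tmult)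
    have c': "c (k + 1) = \<theta> (int k) * \<delta>s k" by (simp add: c_def)
    have \<kappa>': "\<kappa> (k + 1) = (if \<theta> (int k - 1) \<noteq> 1 \<or> \<beta> k = 0
        then \<theta> (int k) / (1 - \<theta> (int k)) else - 1)"
      by (simp add: \<kappa>_def algebra_simps)
    show ?thesis
    proof (cases "G = 0 \<or> P = 0")
      case True
      then have II: "\<beta> k = 0" "\<theta> (int k) = 1 / 2" "\<delta>s k = 1" "\<alpha> k = \<gamma> * U / D"
        "h (k + 1) = h k + \<delta> k *\<^sub>R q k - (2 * \<alpha> k) *\<^sub>R d k" "q (k + 1) = (2 * \<alpha> k) *\<^sub>R d k"
        "\<delta> (k + 1) = 1 / 2" "l (k + 1) = 4 * (\<alpha> k)\<^sup>2 * D" "\<tau> (k + 1) = 2 * \<alpha> k * s"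
        using stage by auto
      \<comment> \<open>Stage I also covers \<open>P = 0\<close> with \<open>G \<noteq> 0\<close>.
        There ASDCD uses its momentum formulas, but they return a zero momentum and the plain step
        length.\<close>
      have I: "B k = 0 \<and> a k = \<alpha> k"
      proof (cases "G = 0")
        case True
        then show ?thesis using degenerate II by simp
      next
        case False
        moreover have "P = 0" using True False by simp
        moreover have "(U * l k - (d k \<bullet> q k) * (q k \<bullet> g k - \<tau> k)) / G = U / D"
          unfolding G_def
          by (rule alpha_no_momentum)
            (use False \<open>P = 0\<close> in \<open>auto simp: G_def P_def D_def\<close>)
        ultimately show ?thesis using a_eq B_eq II by simp
      qed
      \<comment> \<open>Now \<open>c (k + 1) = 1 / 2\<close> cancels the 2 in
        \<open>q (k + 1)\<close>, and \<open>\<beta> k = 0\<close> gives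
        \<open>\<kappa> (k + 1) = 1\<close>.\<close>
      show ?thesis
        unfolding inv_def c' \<kappa>' II(5-9)
        using I z' rho' zk
        by (simp add: II(1-3) power_mult_distrib D_def flip: scaleR_diff_left)
    next
      case False
      then have GP: "G \<noteq> 0" "P \<noteq> 0" by auto
      then have \<alpha>: "\<alpha> k = a k" and \<beta>: "\<beta> k = B k"
        using stage a_eq B_eq by (auto simp: c_def)
      have B0: "B k \<noteq> 0" using B_eq GP c0 \<open>\<gamma> > 0\<close> by simp
      define w where "w = \<delta>s k * \<theta> (int k)"
      have q': "q (k + 1) = q k + (a k / w) *\<^sub>R d k"
        and lt': "l (k + 1) = l k + 2 * (a k / w) * (d k \<bullet> q k) + (a k / w)\<^sup>2 * D"
          "\<tau> (k + 1) = \<tau> k + a k / w * s"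
        using stage GP unfolding \<alpha>
        by (auto simp: w_def power_mult_distrib power_divide split: if_splits)
      \<comment> \<open>\<open>w\<close> is \<open>c (k + 1)\<close>. Once it equals
        \<open>B k * c k\<close>, the new step \<open>- a k *\<^sub>R d k - w *\<^sub>R q k\<close>
        of ASDCD is \<open>- w *\<^sub>R q (k + 1)\<close>.\<close>
      have w: "w = B k * c k \<and> h (k + 1) + \<delta> (k + 1) *\<^sub>R q (k + 1) = z k - a k *\<^sub>R d k - w *\<^sub>R q k \<and>
        (if \<theta> (int k) = 1 then \<delta> (k + 1) = 0
         else \<delta> (k + 1) \<noteq> 0 \<and> \<kappa> (k + 1) * \<delta> (k + 1) = w)"
      proof (cases "\<theta> (int k - 1) = 1")
        \<comment> \<open>Here \<open>\<delta> k = 0\<close>, so \<open>z k = h k\<close>, and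
          \<open>\<delta> (k + 1) = - w\<close>. As \<open>\<beta> k \<noteq> 0\<close>, the factor
          \<open>\<kappa> (k + 1)\<close> is \<open>- 1\<close>, which restores the sign.\<close>
        case True
        then have II: "\<delta>s k = 2 * \<delta>s (k - 1) * \<beta> k" "\<theta> (int k) = 1 / 2"
          "h (k + 1) = h k" "\<delta> (k + 1) = - \<theta> (int k) * \<delta>s k"
          using stage GP by auto
        have wB: "w = B k * c k" using True II \<beta> by (simp add: w_def c_def)
        then have "w \<noteq> 0" using B0 c0 by simp
        moreover have "\<delta> k = 0" using True del by simp
        ultimately show ?thesis
          using True II wB B0 c0 zk unfolding \<kappa>' \<beta> q' by (simp add: w_def algebra_simps)
      next
        case False
        then have \<kappa>: "\<delta> k \<noteq> 0" "\<kappa> k * \<delta> k = c k" using del by auto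
        have II: "\<delta>s k = \<delta> k" "\<theta> (int k) = \<kappa> k * \<beta> k"
          "h (k + 1) = h k - (\<alpha> k / \<theta> (int k)) *\<^sub>R d k" "\<delta> (k + 1) = (1 - \<theta> (int k)) * \<delta> k"
          using stage GP False by (auto simp: \<kappa>_def)
        have wB: "w = B k * c k" using \<kappa> II \<beta> by (simp add: w_def mult_ac)
        then have "w \<noteq> 0" using B0 c0 by simp
        have \<theta>0: "\<theta> (int k) \<noteq> 0" using \<open>w \<noteq> 0\<close> w_def by auto
        \<comment> \<open>Along \<open>d k\<close>, the excess
          \<open>a k / \<theta> (int k) - a k\<close> contributed by \<open>q (k + 1)\<close>
          reduces the move of \<open>h\<close> to the step length \<open>a k\<close>.\<close>
        have coeff_d: "\<delta> (k + 1) * (a k / w) = a k / \<theta> (int k) - a k"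
          unfolding II(4) w_def II(1) using \<theta>0 \<kappa>(1) by (simp add: field_simps)
        have coeff_q: "\<delta> (k + 1) = \<delta> k - w" using II by (simp add: w_def algebra_simps)
        have "h (k + 1) + \<delta> (k + 1) *\<^sub>R q (k + 1) = z k - a k *\<^sub>R d k - w *\<^sub>R q k"
          unfolding q' scaleR_add_right scaleR_scaleR coeff_d II(3) \<alpha> zk
          unfolding coeff_q by (simp add: algebra_simps)
        \<comment> \<open>If \<open>\<theta> (int k) = 1\<close>, then
          \<open>\<delta> (k + 1)\<close> vanishes; otherwise \<open>\<kappa> (k + 1)\<close>
          cancels its factor \<open>1 - \<theta> (int k)\<close>.\<close>
        then show ?thesis
          using False wB II \<kappa> unfolding \<kappa>' by (auto simp: w_def mult_ac)
      qed
      have w0: "w \<noteq> 0" using w B0 c0 by simp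
      have cw: "c (k + 1) = w" by (simp add: c_def w_def)
      have "l (k + 1) = (norm (q (k + 1)))\<^sup>2"
        unfolding q' lt' l D_def power2_norm_eq_inner
        by (simp add: inner_add_left inner_add_right inner_commute power2_eq_square algebra_simps)
      moreover have "z (k + 1) - z k = - w *\<^sub>R q (k + 1)"
        using z' w w0 unfolding q' by (simp add: scaleR_add_right)
      moreover have "\<rho> (k + 1) = - w * \<tau> (k + 1)"
        using w0 unfolding lt' rho' conjunct1[OF w, symmetric] by (simp add: algebra_simps)
      moreover have "z (k + 1) = h (k + 1) + \<delta> (k + 1) *\<^sub>R q (k + 1)"
        using z' w by simp
      ultimately show ?thesis unfolding inv_def cw using w w0 by (auto simp del: of_nat_add)
    qed
  qed

  define v where "v = transpose A *v \<xi>0"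
  have init: "h 0 = z0" "q 0 = 0" "h 1 = z0 + 2 *\<^sub>R v" "q 1 = - 2 *\<^sub>R v" "\<delta> 1 = 1 / 2"
    "z 1 = z0 + v"
    using h_init(1,2) z_init(2) unfolding v_def by blast+
  \<comment> \<open>The factors 2 and \<open>1 / 2\<close> in the initialization correspond to
    \<open>c 1 = 1 / 2\<close> and \<open>\<kappa> 1 = 1\<close>.\<close>
  have inv_1: "inv 1"
    unfolding inv_def c_def \<kappa>_def init h_init(7,8) z_init(3)
    by (simp add: h_init(3-6) z_init(1) scaleR_2)
  have "inv k" if "k \<ge> 1" for k
    using that by (induction k rule: nat_induct_at_least) (use inv_1 inv_step in auto)
  then have "z k = h k + \<delta> k *\<^sub>R q k" if "k \<ge> 1" for k
    using that by (simp add: inv_def)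
  moreover have "z 0 = h 0 + \<delta> 0 *\<^sub>R q 0"
    using init z_init by simp
  ultimately show ?thesis by (metis less_one not_le)
qed

end
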